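(* Let $\mathcal A$ be a von Neumann algebra on a Hilbert space $\mathcal H$ with cyclic and separating vector $\Omega$, let $(\mathcal A_t)_{t\ge 0}$ be a filtration of $\mathcal A$ with normal conditional expectations $\mathbb E_t:\mathcal A\to\mathcal A_t$ leaving the vector state $\omega=\langle\,\cdot\,\Omega,\Omega\rangle$ invariant, let $P_t$ be the associated orthogonal projections on $\mathcal H$, and let $\tau=(q_t)$ be a stopping time. Then for every $u\in(0,+\infty]$ the time projection $M_\tau(u)$ satisfies $$M_\tau(u)=\bigwedge_{t\le u}\bigl(q_u-q_tP_t^{\perp}\bigr),$$ where $t$ ranges over $[0,u]$, $P_t^\perp=\boldsymbol 1-P_t$, and $\bigwedge$ is the infimum in the lattice of orthogonal projections on $\mathcal H$.
   Context: Setting. $\mathcal A$ is a von Neumann algebra acting on a Hilbert space $\mathcal H$ with a cyclic and separating vector $\Omega$, and $\omega$ is the (normal faithful) vector state on $\mathcal A$ induced by $\Omega$. A filtration is an increasing family $(\mathcal A_t)_{t\ge0}$ of von Neumann subalgebras of $\mathcal A$ with $\mathcal A=\mathcal A_\infty:=(\bigcup_{t\ge0}\mathcal A_t)''$. It is assumed that for each $t\ge 0$ there is a normal conditional expectation $\mathbb E_t$ from $\mathcal A$ onto $\mathcal A_t$ with $\omega\circ\mathbb E_t=\omega$. $P_t$ is the orthogonal projection of $\mathcal H$ onto $\mathcal H_t=\overline{\mathcal A_t\Omega}$; it is determined by $P_t(x\Omega)=(\mathbb E_tx)\Omega$ for $x\in\mathcal A$, and $P_t\in\mathcal A_t'$.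 For $t=\infty$: $\mathbb E_\infty=\mathrm{id}$ and $P_\infty=\boldsymbol 1$. Stopping time. A stopping time $\tau$ is an increasing family $(q_t)$ of projections, indexed by $t\in[0,+\infty)$ or by $t\in[0,+\infty]$, with $q_t\in\mathcal A_t$, $q_0=0$, and $\bigvee_{t\ge0}q_t=\boldsymbol 1$ if the index set is $[0,+\infty)$, respectively $q_\infty=\boldsymbol 1$ if the index set is $[0,+\infty]$. In the case of index set $[0,+\infty)$, put $q_\infty:=\boldsymbol 1$. Time projection. Let $u\in(0,+\infty]$. For a finite partition $\theta=\{0=t_0<t_1<\dots<t_n=u\}$ of $[0,u]$ put $$M_{\tau(\theta)}(u)=\sum_{i=1}^n(q_{t_i}-q_{t_{i-1}})P_{t_i}.$$ Each $M_{\tau(\theta)}(u)$ is an orthogonal projection on $\mathcal H$, and the net $\{M_{\tau(\theta)}(u)\}_\theta$ is decreasing as $\theta$ refines. The time projection is its strong limit $M_\tau(u)=\lim_\theta M_{\tau(\theta)}(u)=\bigwedge_\theta M_{\tau(\theta)}(u)$. *)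

theory Defs
  imports "HOL-Analysis.Analysis"
begin

section \<open>Complex Hilbert spaces\<close>

text \<open>The inner product is linear in the first argument.\<close>

class complex_hilbert_space = banach +
  fixes scaleC :: "complex \<Rightarrow> 'a \<Rightarrow> 'a" (infixr "*\<^sub>C" 75)
    and cinner :: "'a \<Rightarrow> 'a \<Rightarrow> complex"
  assumes scaleC_add_right: "c *\<^sub>C (x + y) = c *\<^sub>C x + c *\<^sub>C y"
    and scaleC_add_left: "(c + d) *\<^sub>C x = c *\<^sub>C x + d *\<^sub>C x"
    and scaleC_scaleC: "c *\<^sub>C d *\<^sub>C x = (c * d) *\<^sub>C x"
    and scaleR_scaleC: "r *\<^sub>R x = complex_of_real r *\<^sub>C x"
    and cinner_add_left: "cinner (x + y) z = cinner x z + cinner y z"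
    and cinner_scaleC_left: "cinner (c *\<^sub>C x) y = c * cinner x y"
    and cinner_commute: "cinner x y = cnj (cinner y x)"
    and cinner_self_norm: "cinner x x = complex_of_real ((norm x)\<^sup>2)"
begin

lemma cinner_add_right: "cinner x (y + z) = cinner x y + cinner x z"
  by (metis cinner_add_left cinner_commute complex_cnj_add)

lemma cinner_scaleC_right: "cinner x (c *\<^sub>C y) = cnj c * cinner x y"
  by (metis cinner_scaleC_left cinner_commute complex_cnj_mult)

lemma cinner_zero_left: "cinner 0 x = 0"
  using cinner_add_left[of 0 0 x] by simp

lemma cinner_eq_zero_iff: "cinner x x = 0 \<longleftrightarrow> x = 0"
  by (simp add: cinner_self_norm)

lemma norm_scaleC: "norm (c *\<^sub>C x) = cmod c * norm x"
proof -
  have "complex_of_real ((norm (c *\<^sub>C x))\<^sup>2) = c * cnj c * complex_of_real ((norm x)\<^sup>2)"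
    by (simp only: cinner_self_norm[symmetric] cinner_scaleC_left cinner_scaleC_right mult_ac)
  also have "\<dots> = complex_of_real ((cmod c * norm x)\<^sup>2)"
    by (simp add: complex_norm_square[symmetric] power_mult_distrib)
  finally have "(norm (c *\<^sub>C x))\<^sup>2 = (cmod c * norm x)\<^sup>2"
    by (simp only: of_real_eq_iff)
  then show ?thesis by simp
qed

end

instantiation complex :: complex_hilbert_space
begin
definition scaleC_complex :: "complex \<Rightarrow> complex \<Rightarrow> complex"
  where "scaleC_complex c x = c * x"
definition cinner_complex :: "complex \<Rightarrow> complex \<Rightarrow> complex"
  where "cinner_complex x y = x * cnj y"
instance
  by standard
    (auto simp: scaleC_complex_def cinner_complex_def algebra_simps scaleR_conv_of_real
      complex_norm_square[symmetric])
end


section \<open>Bounded operators\<close>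

typedef (overloaded) 'a bounded_op =
  "{T :: 'a::complex_hilbert_space \<Rightarrow> 'a. bounded_linear T \<and> (\<forall>c x. T (c *\<^sub>C x) = c *\<^sub>C T x)}"
  morphisms apply_op Abs_op
  by (rule exI[of _ "\<lambda>x. x"]) simp

setup_lifting type_definition_bounded_op

lemma apply_op_eqI: "(\<And>v. apply_op S v = apply_op T v) \<Longrightarrow> S = T"
  by (simp add: apply_op_inject[symmetric] ext)

lemma bounded_linear_apply_op: "bounded_linear (apply_op T)"
  using apply_op[of T] by simp

lemma apply_op_scaleC: "apply_op T (c *\<^sub>C v) = c *\<^sub>C apply_op T v"
  using apply_op[of T] by simp

lemma apply_op_add: "apply_op T (v + w) = apply_op T v + apply_op T w"
  using bounded_linear_apply_op[of T] by (simp add: linear_simps)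

lemma apply_op_diff: "apply_op T (v - w) = apply_op T v - apply_op T w"
  using bounded_linear_apply_op[of T] by (simp add: linear_simps)

lemma scaleC_diff_right: "c *\<^sub>C (x - y) = c *\<^sub>C x - c *\<^sub>C (y :: 'a::complex_hilbert_space)"
  using scaleC_add_right[of c "x - y" y] by (simp add: algebra_simps)

lemma scaleC_zero_right: "c *\<^sub>C (0 :: 'a::complex_hilbert_space) = 0"
  using scaleC_diff_right[of c 0 0] by simp

lemma scaleC_minus_right: "c *\<^sub>C (- x) = - (c *\<^sub>C (x :: 'a::complex_hilbert_space))"
  using scaleC_diff_right[of c 0 x] by (simp add: scaleC_zero_right)

lemma bounded_linear_scaleC: "bounded_linear (\<lambda>v :: 'a::complex_hilbert_space. c *\<^sub>C v)"
  by (rule bounded_linear_intro[where K = "cmod c"])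
    (simp_all add: scaleC_add_right scaleR_scaleC scaleC_scaleC norm_scaleC mult.commute)

instantiation bounded_op :: (complex_hilbert_space) "{ring, monoid_mult}"
begin

lift_definition zero_bounded_op :: "'a bounded_op" is "\<lambda>v. 0"
  by (simp add: scaleC_zero_right)
lift_definition one_bounded_op :: "'a bounded_op" is "\<lambda>v. v"
  by simp
lift_definition plus_bounded_op :: "'a bounded_op \<Rightarrow> 'a bounded_op \<Rightarrow> 'a bounded_op"
  is "\<lambda>S T v. S v + T v"
  by (simp add: bounded_linear_add scaleC_add_right)
lift_definition minus_bounded_op :: "'a bounded_op \<Rightarrow> 'a bounded_op \<Rightarrow> 'a bounded_op"
  is "\<lambda>S T v. S v - T v"
  by (simp add: bounded_linear_sub scaleC_diff_right)
lift_definition uminus_bounded_op :: "'a bounded_op \<Rightarrow> 'a bounded_op" is "\<lambda>T v. - T v"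
  by (simp add: bounded_linear_minus scaleC_minus_right)
lift_definition times_bounded_op :: "'a bounded_op \<Rightarrow> 'a bounded_op \<Rightarrow> 'a bounded_op"
  is "\<lambda>S T v. S (T v)"
  by (simp add: bounded_linear_compose)

instance
proof
  fix a b c :: "'a bounded_op"
  show "a + b + c = a + (b + c)" "a + b = b + a" "0 + a = a" "- a + a = 0" "a - b = a + - b"
    "a * b * c = a * (b * c)" "1 * a = a" "a * 1 = a" "(a + b) * c = a * c + b * c"
    by (rule apply_op_eqI; simp add: plus_bounded_op.rep_eq minus_bounded_op.rep_eq
          uminus_bounded_op.rep_eq zero_bounded_op.rep_eq one_bounded_op.rep_eq
          times_bounded_op.rep_eq add_ac)+
  show "a * (b + c) = a * b + a * c"
    by (rule apply_op_eqI)
      (simp add: times_bounded_op.rep_eq plus_bounded_op.rep_eq apply_op_add)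
qed

end

lift_definition scaleC_op :: "complex \<Rightarrow> 'a::complex_hilbert_space bounded_op \<Rightarrow> 'a bounded_op"
  is "\<lambda>c T v. c *\<^sub>C T v"
  by (auto intro: bounded_linear_compose[OF bounded_linear_scaleC]
      simp: scaleC_scaleC mult.commute)

lemma op_eq_zeroI:
  assumes "\<And>v. cinner (apply_op T v) v = 0"
  shows "T = 0"
proof (rule apply_op_eqI)
  fix v
  let ?w = "apply_op T v"
  have 1: "cinner (apply_op T v) w + cinner (apply_op T w) v = 0" for w
    using assms[of "v + w"] assms[of v] assms[of w]
    by (simp add: apply_op_add cinner_add_left cinner_add_right algebra_simps)
  have "\<i> * (cinner (apply_op T ?w) v - cinner ?w ?w) = 0"
    using 1[of "\<i> *\<^sub>C ?w"]
    by (simp add: apply_op_scaleC cinner_scaleC_left cinner_scaleC_right algebra_simps)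
  with 1[of ?w] have "cinner ?w ?w = 0"
    by simp
  then show "?w = apply_op 0 v"
    by (simp add: cinner_eq_zero_iff zero_bounded_op.rep_eq)
qed

instantiation bounded_op :: (complex_hilbert_space) ordered_ab_group_add
begin

definition less_eq_bounded_op :: "'a bounded_op \<Rightarrow> 'a bounded_op \<Rightarrow> bool"
  where "S \<le> T \<longleftrightarrow> (\<forall>v. cinner (apply_op (T - S) v) v \<in> \<real>\<^sub>\<ge>\<^sub>0)"
definition less_bounded_op :: "'a bounded_op \<Rightarrow> 'a bounded_op \<Rightarrow> bool"
  where "(S :: 'a bounded_op) < T \<longleftrightarrow> S \<le> T \<and> \<not> T \<le> S"

instance
proof
  fix a b c :: "'a bounded_op"
  show "a < b \<longleftrightarrow> a \<le> b \<and> \<not> b \<le> a"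
    by (rule less_bounded_op_def)
  show "a \<le> a"
    by (simp add: less_eq_bounded_op_def zero_bounded_op.rep_eq cinner_zero_left)
  show "a \<le> c" if "a \<le> b" "b \<le> c"
  proof -
    have "apply_op (c - a) v = apply_op (b - a) v + apply_op (c - b) v" for v
      by (simp add: minus_bounded_op.rep_eq)
    with that show ?thesis
      by (auto simp: less_eq_bounded_op_def cinner_add_left intro: nonneg_Reals_add_I)
  qed
  show "a = b" if "a \<le> b" "b \<le> a"
  proof -
    have "cinner (apply_op (b - a) v) v = 0" for v
    proof -
      have "apply_op (b - a) v + apply_op (a - b) v = 0"
        by (simp add: minus_bounded_op.rep_eq)
      then have "cinner (apply_op (b - a) v) v + cinner (apply_op (a - b) v) v = 0"
        by (metis cinner_add_left cinner_zero_left)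
      with that show ?thesis
        by (force simp: less_eq_bounded_op_def complex_nonneg_Reals_iff complex_eq_iff
            dest!: spec[of _ v])
    qed
    then show ?thesis using op_eq_zeroI by fastforce
  qed
  show "c + a \<le> c + b" if "a \<le> b"
    using that by (simp add: less_eq_bounded_op_def)
qed

end

definition is_adjoint :: "'a::complex_hilbert_space bounded_op \<Rightarrow> 'a bounded_op \<Rightarrow> bool"
  where "is_adjoint S T \<longleftrightarrow> (\<forall>v w. cinner (apply_op S v) w = cinner v (apply_op T w))"

definition is_projection :: "'a::complex_hilbert_space bounded_op \<Rightarrow> bool"
  where "is_projection p \<longleftrightarrow> p * p = p \<and> is_adjoint p p"

definition is_projection_onto :: "'a::complex_hilbert_space bounded_op \<Rightarrow> 'a set \<Rightarrow> bool"
  where "is_projection_onto p K \<longleftrightarrow> is_projection p \<and> range (apply_op p) = K"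

text \<open>Infimum and supremum in the lattice of orthogonal projections.\<close>

definition is_projection_Inf ::
    "'a::complex_hilbert_space bounded_op set \<Rightarrow> 'a bounded_op \<Rightarrow> bool"
  where "is_projection_Inf S p \<longleftrightarrow> S \<subseteq> Collect is_projection \<and> is_projection p \<and>
    (\<forall>s\<in>S. p \<le> s) \<and> (\<forall>r. is_projection r \<longrightarrow> (\<forall>s\<in>S. r \<le> s) \<longrightarrow> r \<le> p)"

definition is_projection_Sup ::
    "'a::complex_hilbert_space bounded_op set \<Rightarrow> 'a bounded_op \<Rightarrow> bool"
  where "is_projection_Sup S p \<longleftrightarrow> S \<subseteq> Collect is_projection \<and> is_projection p \<and>
    (\<forall>s\<in>S. s \<le> p) \<and> (\<forall>r. is_projection r \<longrightarrow> (\<forall>s\<in>S. s \<le> r) \<longrightarrow> p \<le> r)"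

definition strong_limit ::
    "'b filter \<Rightarrow> ('b \<Rightarrow> 'a::complex_hilbert_space bounded_op) \<Rightarrow> 'a bounded_op \<Rightarrow> bool"
  where "strong_limit F X T \<longleftrightarrow> (\<forall>v. ((\<lambda>i. apply_op (X i) v) \<longlongrightarrow> apply_op T v) F)"

lemma strong_limit_unique:
  assumes "F \<noteq> bot" "strong_limit F X S" "strong_limit F X T"
  shows "S = T"
  by (rule apply_op_eqI)
    (use assms in \<open>auto simp: strong_limit_def intro: tendsto_unique\<close>)


section \<open>Von Neumann algebras and conditional expectations\<close>

definition commutant :: "'a::complex_hilbert_space bounded_op set \<Rightarrow> 'a bounded_op set"
  where "commutant S = {T. \<forall>X\<in>S. T * X = X * T}"

text \<open>Self-adjoint sets of operators equal to their double commutant; these are automatically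
  subalgebras containing the identity operator.\<close>

definition von_neumann_algebra :: "'a::complex_hilbert_space bounded_op set \<Rightarrow> bool"
  where "von_neumann_algebra M \<longleftrightarrow>
    (\<forall>x\<in>M. \<exists>y\<in>M. is_adjoint x y) \<and> commutant (commutant M) = M"

definition cyclic_vector :: "'a::complex_hilbert_space bounded_op set \<Rightarrow> 'a \<Rightarrow> bool"
  where "cyclic_vector M \<Omega> \<longleftrightarrow> closure ((\<lambda>x. apply_op x \<Omega>) ` M) = UNIV"

definition separating_vector :: "'a::complex_hilbert_space bounded_op set \<Rightarrow> 'a \<Rightarrow> bool"
  where "separating_vector M \<Omega> \<longleftrightarrow> (\<forall>x\<in>M. apply_op x \<Omega> = 0 \<longrightarrow> x = 0)"

definition vector_functional :: "'a::complex_hilbert_space \<Rightarrow> 'a bounded_op \<Rightarrow> complex"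
  where "vector_functional \<Omega> x = cinner (apply_op x \<Omega>) \<Omega>"

definition self_adjoint_part :: "'a::complex_hilbert_space bounded_op set \<Rightarrow> 'a bounded_op set"
  where "self_adjoint_part M = {x \<in> M. is_adjoint x x}"

definition is_lub_in ::
    "'a::complex_hilbert_space bounded_op set \<Rightarrow> 'a bounded_op set \<Rightarrow> 'a bounded_op \<Rightarrow> bool"
  where "is_lub_in M D x \<longleftrightarrow> x \<in> self_adjoint_part M \<and> (\<forall>d\<in>D. d \<le> x) \<and>
    (\<forall>y\<in>self_adjoint_part M. (\<forall>d\<in>D. d \<le> y) \<longrightarrow> x \<le> y)"

text \<open>Normality of a positive map: it preserves suprema of upward directed families.\<close>

definition normal_map ::
    "'a::complex_hilbert_space bounded_op set \<Rightarrow> 'a bounded_op set \<Rightarrow>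
      ('a bounded_op \<Rightarrow> 'a bounded_op) \<Rightarrow> bool"
  where "normal_map M N E \<longleftrightarrow>
    (\<forall>D x. D \<subseteq> self_adjoint_part M \<longrightarrow> D \<noteq> {} \<longrightarrow>
      (\<forall>a\<in>D. \<forall>b\<in>D. \<exists>c\<in>D. a \<le> c \<and> b \<le> c) \<longrightarrow>
      is_lub_in M D x \<longrightarrow> is_lub_in N (E ` D) (E x))"

definition conditional_expectation ::
    "'a::complex_hilbert_space bounded_op set \<Rightarrow> 'a bounded_op set \<Rightarrow>
      ('a bounded_op \<Rightarrow> 'a bounded_op) \<Rightarrow> bool"
  where "conditional_expectation M N E \<longleftrightarrow>
    (\<forall>x\<in>M. \<forall>y\<in>M. E (x + y) = E x + E y) \<and>
    (\<forall>c. \<forall>x\<in>M. E (scaleC_op c x) = scaleC_op c (E x)) \<and>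
    (\<forall>x\<in>M. 0 \<le> x \<longrightarrow> 0 \<le> E x) \<and>
    E ` M = N \<and> (\<forall>b\<in>N. E b = b) \<and>
    (\<forall>a\<in>N. \<forall>b\<in>N. \<forall>x\<in>M. E (a * x * b) = a * E x * b)"


section \<open>Filtrations, stopping times and time projections\<close>

text \<open>Times are elements of \<open>[0, \<infinity>]\<close>, with \<open>\<infinity>\<close> written \<open>top\<close>.\<close>

definition filtration ::
    "'a::complex_hilbert_space bounded_op set \<Rightarrow> (ennreal \<Rightarrow> 'a bounded_op set) \<Rightarrow> bool"
  where "filtration M A \<longleftrightarrow>
    (\<forall>t<top. von_neumann_algebra (A t) \<and> A t \<subseteq> M) \<and> mono_on {0..<top} A \<and>
    A top = M \<and> M = commutant (commutant (\<Union>t\<in>{0..<top}. A t))"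

definition compatible_expectations ::
    "'a::complex_hilbert_space bounded_op set \<Rightarrow> 'a \<Rightarrow> (ennreal \<Rightarrow> 'a bounded_op set) \<Rightarrow>
      (ennreal \<Rightarrow> 'a bounded_op \<Rightarrow> 'a bounded_op) \<Rightarrow> bool"
  where "compatible_expectations M \<Omega> A E \<longleftrightarrow>
    (\<forall>t<top. conditional_expectation M (A t) (E t) \<and> normal_map M (A t) (E t) \<and>
      (\<forall>x\<in>M. vector_functional \<Omega> (E t x) = vector_functional \<Omega> x)) \<and>
    (\<forall>x\<in>M. E top x = x)"

definition filtration_projections ::
    "'a::complex_hilbert_space \<Rightarrow> (ennreal \<Rightarrow> 'a bounded_op set) \<Rightarrow>
      (ennreal \<Rightarrow> 'a bounded_op) \<Rightarrow> bool"
  where "filtration_projections \<Omega> A P \<longleftrightarrow>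
    (\<forall>t<top. is_projection_onto (P t) (closure ((\<lambda>x. apply_op x \<Omega>) ` A t))) \<and> P top = 1"

definition stopping_time_on ::
    "ennreal set \<Rightarrow> (ennreal \<Rightarrow> 'a::complex_hilbert_space bounded_op set) \<Rightarrow>
      (ennreal \<Rightarrow> 'a bounded_op) \<Rightarrow> bool"
  where "stopping_time_on I A q \<longleftrightarrow>
    (\<forall>t\<in>I. is_projection (q t) \<and> q t \<in> A t) \<and> mono_on I q \<and> q 0 = 0"

text \<open>The first disjunct is a stopping time indexed by \<open>[0, \<infinity>)\<close>, extended to \<open>\<infinity>\<close> by the
  identity; the second one is a stopping time indexed by \<open>[0, \<infinity>]\<close>.\<close>

definition stopping_time ::
    "(ennreal \<Rightarrow> 'a::complex_hilbert_space bounded_op set) \<Rightarrow> (ennreal \<Rightarrow> 'a bounded_op) \<Rightarrow> bool"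
  where "stopping_time A q \<longleftrightarrow>
    stopping_time_on {0..<top} A q \<and> is_projection_Sup (q ` {0..<top}) 1 \<and> q top = 1 \<or>
    stopping_time_on {0..top} A q \<and> q top = 1"

definition partitions :: "ennreal \<Rightarrow> ennreal set set"
  where "partitions u = {\<theta>. finite \<theta> \<and> {0, u} \<subseteq> \<theta> \<and> \<theta> \<subseteq> {0..u}}"

definition refinement :: "ennreal \<Rightarrow> ennreal set filter"
  where "refinement u = (INF \<theta>\<in>partitions u. principal {\<theta>'\<in>partitions u. \<theta> \<subseteq> \<theta>'})"

lemma eventually_refinement:
  "eventually X (refinement u) \<longleftrightarrow>
    (\<exists>\<theta>\<in>partitions u. \<forall>\<theta>'\<in>partitions u. \<theta> \<subseteq> \<theta>' \<longrightarrow> X \<theta>')"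
  unfolding refinement_def
proof (subst eventually_INF_base)
  show "partitions u \<noteq> {}"
    by (auto simp: partitions_def intro!: exI[of _ "{0, u}"])
  show "\<exists>\<theta>\<in>partitions u. principal {\<theta>'\<in>partitions u. \<theta> \<subseteq> \<theta>'} \<le>
      inf (principal {\<theta>'\<in>partitions u. \<theta>1 \<subseteq> \<theta>'}) (principal {\<theta>'\<in>partitions u. \<theta>2 \<subseteq> \<theta>'})"
    if "\<theta>1 \<in> partitions u" "\<theta>2 \<in> partitions u" for \<theta>1 \<theta>2
    using that by (intro bexI[of _ "\<theta>1 \<union> \<theta>2"]) (auto simp: partitions_def)
qed (auto simp: eventually_principal)

lemma refinement_neq_bot: "refinement u \<noteq> bot"
  unfolding trivial_limit_def eventually_refinement by auto

definition partition_sum ::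
    "(ennreal \<Rightarrow> 'a::complex_hilbert_space bounded_op) \<Rightarrow> (ennreal \<Rightarrow> 'a bounded_op) \<Rightarrow>
      ennreal set \<Rightarrow> 'a bounded_op"
  where "partition_sum q P \<theta> = (let t = sorted_list_of_set \<theta> in
    \<Sum>i = 1..<length t. (q (t ! i) - q (t ! (i - 1))) * P (t ! i))"

definition time_projection ::
    "(ennreal \<Rightarrow> 'a::complex_hilbert_space bounded_op) \<Rightarrow> (ennreal \<Rightarrow> 'a bounded_op) \<Rightarrow>
      ennreal \<Rightarrow> 'a bounded_op"
  where "time_projection q P u = (THE M. strong_limit (refinement u) (partition_sum q P) M)"

lemma time_projection_eqI:
  "strong_limit (refinement u) (partition_sum q P) M \<Longrightarrow> time_projection q P u = M"
  unfolding time_projection_def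
  using strong_limit_unique[OF refinement_neq_bot] by blast

end

theory Submission
  imports Defs
begin

text \<open>Since \<open>q s\<close> commutes with \<open>P t\<close> for \<open>s \<le> t\<close>, each \<open>q u - q t * (1 - P t)\<close> is a projection, and the
  partition sum over \<open>\<theta>\<close> is the projection onto the common range of those with \<open>t \<in> \<theta>\<close>: the
  operators \<open>q t * (1 - P t)\<close> annihilate every summand, while on a vector of the common range
  \<open>q t * P t\<close> acts as \<open>q t\<close>, so that the sum telescopes to \<open>q u - q 0\<close>. Hence the partition sums
  decrease under refinement, and their strong limit is the projection onto the intersection of
  all these ranges.\<close>

section \<open>Self-adjoint operators and projections\<close>

lemmas apply_op_simps = plus_bounded_op.rep_eq minus_bounded_op.rep_eq times_bounded_op.rep_eq
  zero_bounded_op.rep_eq one_bounded_op.rep_eq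

lemma apply_op_mult: "apply_op (S * T) v = apply_op S (apply_op T v)"
  by (simp add: times_bounded_op.rep_eq)

lemma cinner_diff_left: "cinner (x - y) z = cinner x z - cinner y (z :: 'a::complex_hilbert_space)"
  using cinner_add_left[of "x - y" y z] by simp

lemma cinner_diff_right: "cinner x (y - z) = cinner x y - cinner x (z :: 'a::complex_hilbert_space)"
  using cinner_add_right[of x "y - z" z] by simp

lemma cinner_zero_right: "cinner x (0 :: 'a::complex_hilbert_space) = 0"
  using cinner_diff_right[of x 0 0] by simp

lemma is_adjoint_zero: "is_adjoint 0 0"
  by (simp add: is_adjoint_def apply_op_simps cinner_zero_left cinner_zero_right)

lemma is_adjoint_one: "is_adjoint 1 1"
  by (simp add: is_adjoint_def apply_op_simps)

lemma is_adjoint_add: "is_adjoint S S' \<Longrightarrow> is_adjoint T T' \<Longrightarrow> is_adjoint (S + T) (S' + T')"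
  by (simp add: is_adjoint_def apply_op_simps cinner_add_left cinner_add_right)

lemma is_adjoint_diff: "is_adjoint S S' \<Longrightarrow> is_adjoint T T' \<Longrightarrow> is_adjoint (S - T) (S' - T')"
  by (simp add: is_adjoint_def apply_op_simps cinner_diff_left cinner_diff_right)

lemma is_adjoint_mult: "is_adjoint S S' \<Longrightarrow> is_adjoint T T' \<Longrightarrow> is_adjoint (S * T) (T' * S')"
  by (simp add: is_adjoint_def apply_op_simps)

lemma is_adjoint_sum:
  "(\<And>i. i \<in> I \<Longrightarrow> is_adjoint (f i) (g i)) \<Longrightarrow> is_adjoint (sum f I) (sum g I)"
  by (induction I rule: infinite_finite_induct) (simp_all add: is_adjoint_zero is_adjoint_add)

lemma is_adjoint_unique:
  assumes "is_adjoint S T" "is_adjoint S T'"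
  shows "T = T'"
proof (rule apply_op_eqI)
  fix w
  have "cinner v (apply_op T w - apply_op T' w) = 0" for v
    using assms by (simp add: is_adjoint_def cinner_diff_right)
  then show "apply_op T w = apply_op T' w"
    by (metis cinner_eq_zero_iff eq_iff_diff_eq_0)
qed

text \<open>Taking adjoints in \<open>a * b = c\<close> reverses the product and fixes all three
  operators. This turns absorption from one side into absorption from the other.\<close>

lemma self_adjoint_mult_swap:
  assumes "is_adjoint a a" "is_adjoint b b" "is_adjoint c c" "a * b = c"
  shows "b * a = c"
  using is_adjoint_mult[OF assms(1,2)] assms(3,4) is_adjoint_unique by blast

lemma self_adjoint_mult_commuting:
  "is_adjoint a a \<Longrightarrow> is_adjoint b b \<Longrightarrow> a * b = b * a \<Longrightarrow> is_adjoint (a * b) (a * b)"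
  using is_adjoint_mult by metis

lemma projection_fixes_range: "is_projection p \<Longrightarrow> v \<in> range (apply_op p) \<Longrightarrow> apply_op p v = v"
  by (auto simp: is_projection_def simp flip: apply_op_mult)

lemma projection_cinner_self:
  assumes "is_projection p"
  shows "cinner (apply_op p v) v = complex_of_real ((norm (apply_op p v))\<^sup>2)"
  using assms unfolding is_projection_def is_adjoint_def
  by (metis cinner_self_norm times_bounded_op.rep_eq)

lemma is_projection_diff:
  assumes "is_projection p" "is_projection s" "s * p = p"
  shows "is_projection (s - p)"
  using assms self_adjoint_mult_swap[of s p p]
  by (simp add: is_projection_def is_adjoint_diff algebra_simps)

text \<open>Pythagoras: \<open>s - p\<close> is again a projection, so the squared norm of
  \<open>(s - p) v\<close> is its quadratic form at \<open>v\<close>, which splits into those of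
  \<open>s\<close> and \<open>p\<close>.\<close>

lemma norm_projection_diff:
  assumes "is_projection p" "is_projection s" "s * p = p"
  shows "(norm (apply_op s v - apply_op p v))\<^sup>2 = (norm (apply_op s v))\<^sup>2 - (norm (apply_op p v))\<^sup>2"
proof -
  have "complex_of_real ((norm (apply_op (s - p) v))\<^sup>2) =
      complex_of_real ((norm (apply_op s v))\<^sup>2 - (norm (apply_op p v))\<^sup>2)"
    using projection_cinner_self[OF is_projection_diff[OF assms], of v]
      projection_cinner_self[OF assms(1), of v] projection_cinner_self[OF assms(2), of v]
    by (simp add: apply_op_simps cinner_diff_left)
  then show ?thesis
    by (simp only: of_real_eq_iff apply_op_simps)
qed

lemma is_projection_one: "is_projection 1"
  by (simp add: is_projection_def is_adjoint_one)

text \<open>Translates the order by quadratic forms into algebra. For \<open>w\<close> in the range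
  of \<open>r\<close>, the order gives that \<open>s w\<close> is at least as long as
  \<open>w\<close>, and Pythagoras for \<open>s\<close> and \<open>1\<close> then forces
  \<open>s w = w\<close>. Conversely, \<open>s - r\<close> is a projection and hence
  positive.\<close>

lemma projection_le_iff:
  assumes r: "is_projection r" and s: "is_projection s"
  shows "r \<le> s \<longleftrightarrow> s * r = r"
proof
  assume le: "r \<le> s"
  show "s * r = r"
  proof (rule apply_op_eqI)
    fix v
    define w where "w = apply_op r v"
    have rw: "apply_op r w = w"
      by (rule projection_fixes_range[OF r]) (simp add: w_def)
    have "cinner (apply_op s w) w - cinner (apply_op r w) w \<in> \<real>\<^sub>\<ge>\<^sub>0"
      using le by (simp add: less_eq_bounded_op_def apply_op_simps flip: cinner_diff_left)
    then have "(norm w)\<^sup>2 \<le> (norm (apply_op s w))\<^sup>2"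
      unfolding projection_cinner_self[OF r] projection_cinner_self[OF s] rw
      by (simp add: cinner_self_norm complex_nonneg_Reals_iff del: of_real_power)
    moreover have "(norm (w - apply_op s w))\<^sup>2 = (norm w)\<^sup>2 - (norm (apply_op s w))\<^sup>2"
      using norm_projection_diff[OF s is_projection_one, of w] by (simp add: apply_op_simps)
    ultimately have "(norm (w - apply_op s w))\<^sup>2 \<le> 0"
      by simp
    then show "apply_op (s * r) v = apply_op r v"
      by (simp add: apply_op_simps w_def)
  qed
next
  assume "s * r = r"
  from projection_cinner_self[OF is_projection_diff[OF r s this]] show "r \<le> s"
    by (simp add: less_eq_bounded_op_def complex_nonneg_Reals_iff del: of_real_power)
qed


section \<open>Strong limits\<close>

text \<open>Polarization reduces the joint continuity of the inner product to that of the
  norm.\<close>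

lemma cinner_polarization:
  "cinner x y = (complex_of_real ((norm (x + y))\<^sup>2) - complex_of_real ((norm (x - y))\<^sup>2) +
    \<i> * complex_of_real ((norm (x + \<i> *\<^sub>C y))\<^sup>2) - \<i> * complex_of_real ((norm (x - \<i> *\<^sub>C y))\<^sup>2)) / 4"
  unfolding cinner_self_norm[symmetric]
  by (simp add: cinner_add_left cinner_add_right cinner_diff_left cinner_diff_right
      cinner_scaleC_left cinner_scaleC_right algebra_simps)

lemma tendsto_cinner:
  fixes f g :: "'b \<Rightarrow> 'a::complex_hilbert_space"
  assumes "(f \<longlongrightarrow> x) F" "(g \<longlongrightarrow> y) F"
  shows "((\<lambda>i. cinner (f i) (g i)) \<longlongrightarrow> cinner x y) F"
  unfolding cinner_polarization[of "f _"] cinner_polarization[of x]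
  by (intro tendsto_intros assms bounded_linear.tendsto[OF bounded_linear_scaleC]) simp

lemma tendsto_apply_op: "(f \<longlongrightarrow> x) F \<Longrightarrow> ((\<lambda>i. apply_op T (f i)) \<longlongrightarrow> apply_op T x) F"
  by (rule bounded_linear.tendsto[OF bounded_linear_apply_op])

text \<open>Left multiplication by the bounded operator \<open>Y\<close> preserves strong limits, so
  \<open>Y * T\<close> and \<open>T\<close> are limits of the same net.\<close>

lemma strong_limit_mult_left:
  assumes "F \<noteq> bot" "strong_limit F X T" "eventually (\<lambda>i. Y * X i = X i) F"
  shows "Y * T = T"
proof (rule strong_limit_unique[OF assms(1) _ assms(2)])
  show "strong_limit F X (Y * T)"
    unfolding strong_limit_def
  proof
    fix v
    have "((\<lambda>i. apply_op Y (apply_op (X i) v)) \<longlongrightarrow> apply_op (Y * T) v) F"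
      using assms(2) by (simp add: strong_limit_def apply_op_simps tendsto_apply_op)
    then show "((\<lambda>i. apply_op (X i) v) \<longlongrightarrow> apply_op (Y * T) v) F"
      by (rule Lim_transform_eventually)
        (use assms(3) in \<open>auto elim!: eventually_mono simp flip: apply_op_mult\<close>)
  qed
qed

lemma strong_limit_mult_right:
  assumes "F \<noteq> bot" "strong_limit F X T" "eventually (\<lambda>i. X i * r = r) F"
  shows "T * r = r"
proof (rule apply_op_eqI)
  fix v
  have "((\<lambda>i. apply_op (X i * r) v) \<longlongrightarrow> apply_op (T * r) v) F"
    using assms(2) by (simp add: strong_limit_def apply_op_simps)
  moreover have "((\<lambda>i. apply_op (X i * r) v) \<longlongrightarrow> apply_op r v) F"
    by (rule tendsto_eventually) (use assms(3) in \<open>auto elim!: eventually_mono\<close>)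
  ultimately show "apply_op (T * r) v = apply_op r v"
    using assms(1) tendsto_unique by blast
qed

lemma strong_limit_self_adjoint:
  assumes "F \<noteq> bot" "strong_limit F X T" "eventually (\<lambda>i. is_adjoint (X i) (X i)) F"
  shows "is_adjoint T T"
  unfolding is_adjoint_def
proof (intro allI)
  fix v w
  have "((\<lambda>i. cinner (apply_op (X i) v) w) \<longlongrightarrow> cinner (apply_op T v) w) F"
    using assms(2) by (intro tendsto_cinner tendsto_const) (simp add: strong_limit_def)
  moreover have "((\<lambda>i. cinner v (apply_op (X i) w)) \<longlongrightarrow> cinner v (apply_op T w)) F"
    using assms(2) by (intro tendsto_cinner tendsto_const) (simp add: strong_limit_def)
  then have "((\<lambda>i. cinner (apply_op (X i) v) w) \<longlongrightarrow> cinner v (apply_op T w)) F"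
    by (rule Lim_transform_eventually)
      (use assms(3) in \<open>auto elim!: eventually_mono simp: is_adjoint_def\<close>)
  ultimately show "cinner (apply_op T v) w = cinner v (apply_op T w)"
    using assms(1) tendsto_unique by blast
qed

lemma norm_projection_le: "is_projection p \<Longrightarrow> norm (apply_op p v) \<le> norm v"
  using norm_projection_diff[OF _ is_projection_one, of p v]
  by (simp add: apply_op_simps) (smt (verit) norm_ge_zero power2_le_imp_le zero_le_power2)

text \<open>By Pythagoras, the net is Cauchy once \<open>\<parallel>X i v\<parallel>\<^sup>2\<close> is close to its infimum.\<close>

lemma decreasing_projections_convergent:
  fixes X :: "'b \<Rightarrow> 'a::complex_hilbert_space bounded_op"
  assumes "F \<noteq> bot" and proj: "eventually (\<lambda>i. is_projection (X i)) F"
    and decr: "eventually (\<lambda>i. eventually (\<lambda>j. X j \<le> X i) F) F"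
  shows "\<exists>w. ((\<lambda>i. apply_op (X i) v) \<longlongrightarrow> w) F"
proof -
  \<comment> \<open>The hypotheses hold only eventually, so the infimum of the squared norms is
    taken over the indices at which both hold.\<close>
  define I where "I = {i. is_projection (X i) \<and> eventually (\<lambda>j. X j \<le> X i) F}"
  define n where "n i = (norm (apply_op (X i) v))\<^sup>2" for i
  have ev: "eventually (\<lambda>i. i \<in> I) F"
    using eventually_conj[OF proj decr] by (simp add: I_def)
  have ne: "I \<noteq> {}"
    using eventually_happens'[OF assms(1) ev] by auto
  have bdd: "bdd_below (n ` I)"
    by (auto simp: n_def intro!: bdd_belowI[of _ 0])
  have small: "\<exists>i\<in>I. eventually (\<lambda>j. dist (apply_op (X i) v) (apply_op (X j) v) < e) F"
    if "e > 0" for e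
  proof -
    have "Inf (n ` I) < Inf (n ` I) + e\<^sup>2"
      using that by simp
    then obtain i where i: "i \<in> I" "n i < Inf (n ` I) + e\<^sup>2"
      using cInf_lessD[of "n ` I"] ne by blast
    then have "eventually (\<lambda>j. X j \<le> X i) F"
      by (simp add: I_def)
    with ev have "eventually (\<lambda>j. dist (apply_op (X i) v) (apply_op (X j) v) < e) F"
    proof eventually_elim
      case (elim j)
      have "(norm (apply_op (X i) v - apply_op (X j) v))\<^sup>2 = n i - n j"
        unfolding n_def using elim i(1)
        by (intro norm_projection_diff) (auto simp: I_def projection_le_iff)
      moreover have "Inf (n ` I) \<le> n j"
        using elim bdd by (intro cInf_lower) auto
      ultimately have "(norm (apply_op (X i) v - apply_op (X j) v))\<^sup>2 < e\<^sup>2"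
        using i(2) by simp
      then show ?case
        using that by (simp add: dist_norm power_less_imp_less_base)
    qed
    with i show ?thesis by blast
  qed
  have "cauchy_filter (filtermap (\<lambda>i. apply_op (X i) v) F)"
    unfolding cauchy_filter_metric_filtermap
  proof (intro allI impI)
    fix e :: real
    assume "e > 0"
    then obtain i where "eventually (\<lambda>j. dist (apply_op (X i) v) (apply_op (X j) v) < e / 2) F"
      using small[of "e / 2"] by auto
    then show "\<exists>P. eventually P F \<and>
        (\<forall>x y. P x \<and> P y \<longrightarrow> dist (apply_op (X x) v) (apply_op (X y) v) < e)"
      by (intro exI[of _ "\<lambda>j. dist (apply_op (X i) v) (apply_op (X j) v) < e / 2"])
        (auto intro: dist_triangle_half_r)
  qed
  then obtain w where "filtermap (\<lambda>i. apply_op (X i) v) F \<le> nhds w"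
    using cauchy_filter_complete_converges[of "filtermap (\<lambda>i. apply_op (X i) v) F" UNIV]
      complete_UNIV assms(1)
    by (auto simp: filtermap_bot_iff)
  then show ?thesis
    by (auto simp: filterlim_def)
qed

text \<open>The pointwise limits form a linear map, with bound 1 because projections are
  contractions.\<close>

lemma decreasing_projections_strong_limit:
  fixes X :: "'b \<Rightarrow> 'a::complex_hilbert_space bounded_op"
  assumes "F \<noteq> bot" and proj: "eventually (\<lambda>i. is_projection (X i)) F"
    and decr: "eventually (\<lambda>i. eventually (\<lambda>j. X j \<le> X i) F) F"
  obtains T where "strong_limit F X T" "is_projection T"
proof -
  obtain T where T: "((\<lambda>i. apply_op (X i) v) \<longlongrightarrow> T v) F" for v
    using decreasing_projections_convergent[OF assms] by metis
  note unique = tendsto_unique[OF assms(1) T]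
  have "bounded_linear T"
  proof (rule bounded_linear_intro[where K = 1])
    show "T (x + y) = T x + T y" for x y
      using tendsto_add[OF T[of x] T[of y]] by (intro unique) (simp add: apply_op_add)
    show "T (r *\<^sub>R x) = r *\<^sub>R T x" for r x
      using tendsto_scaleR[OF tendsto_const T[of x], of r]
      by (intro unique) (simp add: scaleR_scaleC apply_op_scaleC)
    show "norm (T x) \<le> norm x * 1" for x
      by (rule tendsto_upperbound[OF tendsto_norm[OF T] _ assms(1)])
        (use proj in \<open>auto elim!: eventually_mono intro: norm_projection_le\<close>)
  qed
  moreover have "T (c *\<^sub>C x) = c *\<^sub>C T x" for c x
    using bounded_linear.tendsto[OF bounded_linear_scaleC T[of x], of c]
    by (intro unique) (simp add: apply_op_scaleC)
  ultimately have "apply_op (Abs_op T) = T"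
    by (simp add: Abs_op_inverse)
  with T have lim: "strong_limit F X (Abs_op T)"
    by (simp add: strong_limit_def)
  \<comment> \<open>Idempotence takes two limits: \<open>X i * X j = X j\<close> for late
    \<open>j\<close> gives \<open>X i * T = T\<close>, and letting \<open>i\<close> vary gives
    \<open>T * T = T\<close>.\<close>
  have "eventually (\<lambda>i. X i * Abs_op T = Abs_op T) F"
    using proj decr
  proof eventually_elim
    case (elim i)
    have "eventually (\<lambda>j. X i * X j = X j) F"
      using proj elim(2) by eventually_elim (use elim(1) projection_le_iff in blast)
    then show ?case
      by (rule strong_limit_mult_left[OF assms(1) lim])
  qed
  then have "Abs_op T * Abs_op T = Abs_op T"
    by (rule strong_limit_mult_right[OF assms(1) lim])
  moreover have "is_adjoint (Abs_op T) (Abs_op T)"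
    by (rule strong_limit_self_adjoint[OF assms(1) lim])
      (use proj in \<open>auto elim!: eventually_mono simp: is_projection_def\<close>)
  ultimately show ?thesis
    using that lim by (simp add: is_projection_def)
qed


section \<open>Partition sums\<close>

text \<open>What the partition sums need from the filtration, with times up to infinity included.
  The assumption \<open>commute\<close> reflects that \<open>q s\<close> lies in the algebra at time
  \<open>t\<close> and \<open>P t\<close> in its commutant.\<close>

locale adapted_projections =
  fixes q P :: "ennreal \<Rightarrow> 'a::complex_hilbert_space bounded_op"
  assumes proj_q: "is_projection (q t)" and proj_P: "is_projection (P t)"
    and mono_q: "mono q" and mono_P: "mono P"
    and commute: "s \<le> t \<Longrightarrow> q s * P t = P t * q s"
    and q_0: "q 0 = 0"
begin

lemma q_mult: "s \<le> t \<Longrightarrow> q t * q s = q s" "s \<le> t \<Longrightarrow> q s * q t = q s"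
  using monoD[OF mono_q, of s t] projection_le_iff[OF proj_q proj_q] self_adjoint_mult_swap proj_q
  by (metis is_projection_def)+

lemma P_mult: "s \<le> t \<Longrightarrow> P t * P s = P s" "s \<le> t \<Longrightarrow> P s * P t = P s"
  using monoD[OF mono_P, of s t] projection_le_iff[OF proj_P proj_P] self_adjoint_mult_swap proj_P
  by (metis is_projection_def)+

text \<open>For \<open>t \<le> u\<close> this projects onto the vectors \<open>v\<close> fixed by
  \<open>q u\<close> for which \<open>q t\<close> maps \<open>v\<close> into the range of
  \<open>P t\<close>.\<close>

definition stopped :: "ennreal \<Rightarrow> ennreal \<Rightarrow> 'a bounded_op"
  where "stopped u t = q u - q t * (1 - P t)"

text \<open>Since \<open>q t\<close> commutes with \<open>1 - P t\<close>, their product is a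
  projection; it lies below \<open>q t\<close>, hence below \<open>q u\<close>.\<close>

lemma is_projection_stopped:
  assumes "t \<le> u"
  shows "is_projection (stopped u t)"
  unfolding stopped_def
proof (rule is_projection_diff[OF _ proj_q])
  have "is_projection (1 - P t)"
    by (rule is_projection_diff[OF proj_P is_projection_one]) simp
  moreover have comm: "q t * (1 - P t) = (1 - P t) * q t"
    by (simp add: algebra_simps commute)
  ultimately have "is_adjoint (q t * (1 - P t)) (q t * (1 - P t))"
    using proj_q by (intro self_adjoint_mult_commuting) (auto simp: is_projection_def)
  moreover have "q t * (1 - P t) * (q t * (1 - P t)) = q t * (1 - P t)"
    using \<open>is_projection (1 - P t)\<close> q_mult(1)[of t t] comm
    by (metis is_projection_def mult.assoc order_refl)
  ultimately show "is_projection (q t * (1 - P t))"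
    by (simp add: is_projection_def)
  show "q u * (q t * (1 - P t)) = q t * (1 - P t)"
    using q_mult(1)[OF assms] by (simp flip: mult.assoc)
qed

text \<open>If \<open>r\<close> precedes the interval, \<open>q r * q t\<close> and
  \<open>q r * q s\<close> both equal \<open>q r\<close>, so the increment cancels. If
  \<open>r\<close> follows it, \<open>1 - P r\<close> commutes past the increment and annihilates
  \<open>P t\<close>.\<close>

lemma increment_complement:
  assumes "s \<le> t" "r \<le> s \<or> t \<le> r"
  shows "q r * (1 - P r) * ((q t - q s) * P t) = 0"
  using assms(2)
proof
  assume "r \<le> s"
  have "q r * (1 - P r) = (1 - P r) * q r"
    by (simp add: algebra_simps commute)
  then have "q r * (1 - P r) * ((q t - q s) * P t) = (1 - P r) * (q r * q t - q r * q s) * P t"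
    by (simp add: mult.assoc right_diff_distrib left_diff_distrib)
  also have "q r * q t - q r * q s = 0"
    using \<open>r \<le> s\<close> assms(1) q_mult(2) by simp
  finally show ?thesis by simp
next
  assume "t \<le> r"
  have comm: "(1 - P r) * (q t - q s) = (q t - q s) * (1 - P r)"
    using \<open>t \<le> r\<close> assms(1) commute[of t r] commute[of s r] by (simp add: algebra_simps)
  have "q r * (1 - P r) * ((q t - q s) * P t) = q r * ((1 - P r) * (q t - q s)) * P t"
    by (simp only: mult.assoc)
  also have "\<dots> = q r * (q t - q s) * ((1 - P r) * P t)"
    by (simp only: comm mult.assoc)
  also have "(1 - P r) * P t = 0"
    using P_mult(1)[OF \<open>t \<le> r\<close>] by (simp add: algebra_simps)
  finally show ?thesis by simp
qed

text \<open>Evaluating \<open>P\<close> at the right endpoint makes it commute with both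
  \<open>q s\<close> and \<open>q t\<close>.\<close>

lemma is_adjoint_increment:
  assumes "s \<le> t"
  shows "is_adjoint ((q t - q s) * P t) ((q t - q s) * P t)"
proof -
  have "(q t - q s) * P t = P t * (q t - q s)"
    using assms commute[of t t] commute[of s t] by (simp add: algebra_simps)
  with proj_q proj_P show ?thesis
    unfolding is_projection_def by (intro self_adjoint_mult_commuting is_adjoint_diff) blast+
qed

section \<open>The sum over a fixed partition\<close>

context
  fixes u :: ennreal and \<theta> :: "ennreal set"
  assumes \<theta>: "\<theta> \<in> partitions u"
begin

abbreviation "ts \<equiv> sorted_list_of_set \<theta>"

lemma set_ts: "set ts = \<theta>"
  using \<theta> by (simp add: partitions_def)

lemma ts_le_u: "i < length ts \<Longrightarrow> ts ! i \<le> u"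
  using \<theta> set_ts nth_mem[of i ts] by (auto simp: partitions_def)

lemma ts_mono: "i \<le> j \<Longrightarrow> j < length ts \<Longrightarrow> ts ! i \<le> ts ! j"
  by (rule sorted_nth_mono) simp_all

lemma length_ts: "0 < length ts"
  using \<theta> by (auto simp: partitions_def card_gt_0_iff)

lemma ts_0: "ts ! 0 = 0"
proof -
  have "0 \<in> set ts"
    using \<theta> set_ts by (simp add: partitions_def)
  then obtain j where "j < length ts" "ts ! j = 0"
    by (metis in_set_conv_nth)
  with ts_mono[of 0 j] show ?thesis by simp
qed

lemma ts_last: "ts ! (length ts - 1) = u"
proof -
  have "u \<in> set ts"
    using \<theta> set_ts by (simp add: partitions_def)
  then obtain j where "j < length ts" "ts ! j = u"
    by (metis in_set_conv_nth)
  with ts_mono[of j "length ts - 1"] ts_le_u[of "length ts - 1"] length_ts show ?thesis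
    by simp
qed

lemma is_adjoint_partition_sum: "is_adjoint (partition_sum q P \<theta>) (partition_sum q P \<theta>)"
  unfolding partition_sum_def Let_def
  by (intro is_adjoint_sum is_adjoint_increment ts_mono) auto

text \<open>No point of \<open>\<theta>\<close> lies strictly between consecutive points, so
  \<open>t\<close> is before or after each interval and \<open>increment_complement\<close> applies
  to every summand. The factor \<open>q u\<close> absorbs all increments.\<close>

lemma stopped_mult_partition_sum:
  assumes "t \<in> \<theta>"
  shows "stopped u t * partition_sum q P \<theta> = partition_sum q P \<theta>"
  unfolding partition_sum_def Let_def sum_distrib_left
proof (rule sum.cong[OF refl])
  fix i
  assume "i \<in> {1..<length ts}"
  then have i: "0 < i" "i < length ts" by auto
  obtain k where k: "k < length ts" "t = ts ! k"
    using assms set_ts by (metis in_set_conv_nth)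
  have "t \<le> ts ! (i - 1) \<or> ts ! i \<le> t"
  proof (cases "k < i")
    case True
    then show ?thesis using ts_mono[of k "i - 1"] i k by auto
  next
    case False
    then show ?thesis using ts_mono[of i k] i k by auto
  qed
  then have "q t * (1 - P t) * ((q (ts ! i) - q (ts ! (i - 1))) * P (ts ! i)) = 0"
    by (intro increment_complement ts_mono) (use i in auto)
  moreover have "q u * (q (ts ! i) - q (ts ! (i - 1))) = q (ts ! i) - q (ts ! (i - 1))"
    using i q_mult(1) ts_le_u by (simp add: right_diff_distrib)
  then have "q u * ((q (ts ! i) - q (ts ! (i - 1))) * P (ts ! i)) =
      (q (ts ! i) - q (ts ! (i - 1))) * P (ts ! i)"
    by (simp flip: mult.assoc)
  ultimately show "stopped u t * ((q (ts ! i) - q (ts ! (i - 1))) * P (ts ! i)) =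
      (q (ts ! i) - q (ts ! (i - 1))) * P (ts ! i)"
    by (simp add: stopped_def left_diff_distrib)
qed

text \<open>Here \<open>r\<close> is any operator whose range lies in the common range. It is later
  a lower bound of the family, or a partition sum itself.\<close>

lemma partition_sum_mult:
  assumes "\<And>t. t \<in> \<theta> \<Longrightarrow> stopped u t * r = r"
  shows "partition_sum q P \<theta> * r = r"
proof -
  \<comment> \<open>At \<open>t = 0\<close> the operator \<open>stopped u t\<close> is just
    \<open>q u\<close>.\<close>
  have u: "q u * r = r"
  proof -
    have "0 \<in> \<theta>" using \<theta> by (simp add: partitions_def)
    from assms[OF this] show ?thesis by (simp add: stopped_def q_0)
  qed
  have eq: "q t * P t * r = q t * r" if "t \<in> \<theta>" for t
    using assms[OF that] u by (simp add: stopped_def algebra_simps)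
  have "(q (ts ! i) - q (ts ! (i - 1))) * P (ts ! i) * r = (q (ts ! i) - q (ts ! (i - 1))) * r"
    if "i \<in> {1..<length ts}" for i
  proof -
    from that have i: "0 < i" "i < length ts" by auto
    \<comment> \<open>This form puts \<open>q\<close> directly before \<open>P\<close> at the same
      time, so that \<open>eq\<close> can remove \<open>P\<close>.\<close>
    have d: "(1 - q (ts ! (i - 1))) * q (ts ! i) = q (ts ! i) - q (ts ! (i - 1))"
      using q_mult(2)[of "ts ! (i - 1)" "ts ! i"] ts_mono[of "i - 1" i] i
      by (simp add: left_diff_distrib)
    have "ts ! i \<in> \<theta>"
      using i set_ts nth_mem by blast
    from eq[OF this] show ?thesis
      unfolding d[symmetric] by (simp add: mult.assoc)
  qed
  then have "partition_sum q P \<theta> * r = (\<Sum>i = 1..<length ts. q (ts ! i) - q (ts ! (i - 1))) * r"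
    unfolding partition_sum_def Let_def sum_distrib_right by (intro sum.cong refl)
  also have "{1..<length ts} = {Suc 0..length ts - 1}"
    using length_ts by auto
  also have "(\<Sum>i\<in>{Suc 0..length ts - 1}. q (ts ! i) - q (ts ! (i - 1))) = q u"
    using sum_telescope''[of 0 "length ts - 1" "\<lambda>i. q (ts ! i)"] ts_last by (simp add: ts_0 q_0)
  finally show ?thesis by (simp add: u)
qed

text \<open>Idempotence is the case where \<open>r\<close> is the sum itself.\<close>

lemma is_projection_partition_sum: "is_projection (partition_sum q P \<theta>)"
  using is_adjoint_partition_sum partition_sum_mult[OF stopped_mult_partition_sum]
  by (simp add: is_projection_def)

end

text \<open>The finer sum is absorbed by \<open>stopped u t\<close> for all \<open>t\<close> in
  \<open>\<theta>'\<close>, in particular for those in \<open>\<theta>\<close>, hence by the coarser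
  sum.\<close>

lemma partition_sum_antimono:
  assumes "\<theta> \<in> partitions u" "\<theta>' \<in> partitions u" "\<theta> \<subseteq> \<theta>'"
  shows "partition_sum q P \<theta>' \<le> partition_sum q P \<theta>"
  using assms
  by (auto simp: projection_le_iff is_projection_partition_sum
      intro!: partition_sum_mult stopped_mult_partition_sum)

section \<open>Passage to the limit over refinements\<close>

lemma time_projection_Inf:
  "is_projection_Inf (stopped u ` {0..u}) (time_projection q P u)"
proof -
  let ?F = "refinement u" and ?X = "partition_sum q P"
  have trivial: "{0, u} \<in> partitions u"
    by (auto simp: partitions_def)
  have partition: "eventually (\<lambda>\<theta>. \<theta> \<in> partitions u) ?F"
    using trivial by (auto simp: eventually_refinement)
  have decr: "eventually (\<lambda>\<theta>. eventually (\<lambda>\<theta>'. ?X \<theta>' \<le> ?X \<theta>) ?F) ?F"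
    using partition
    by eventually_elim (auto simp: eventually_refinement intro!: bexI partition_sum_antimono)
  have "eventually (\<lambda>\<theta>. is_projection (?X \<theta>)) ?F"
    using partition by eventually_elim (rule is_projection_partition_sum)
  then obtain T where lim: "strong_limit ?F ?X T" and T: "is_projection T"
    using decreasing_projections_strong_limit[OF refinement_neq_bot _ decr] by blast
  have "T \<le> stopped u t" if "t \<le> u" for t
  proof -
    \<comment> \<open>Every refinement of this partition contains \<open>t\<close>, so
      \<open>stopped u t\<close> eventually absorbs the sums and therefore their limit.\<close>
    have "insert t {0, u} \<in> partitions u"
      using that by (auto simp: partitions_def)
    then have "eventually (\<lambda>\<theta>. stopped u t * ?X \<theta> = ?X \<theta>) ?F"
      unfolding eventually_refinement
      by (rule bexI[rotated]) (auto intro!: stopped_mult_partition_sum)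
    then have "stopped u t * T = T"
      by (rule strong_limit_mult_left[OF refinement_neq_bot lim])
    with that show ?thesis
      by (simp add: projection_le_iff T is_projection_stopped)
  qed
  moreover have "r \<le> T" if r: "is_projection r" "\<And>t. t \<le> u \<Longrightarrow> r \<le> stopped u t" for r
  proof -
    \<comment> \<open>A lower bound \<open>r\<close> is thus absorbed by every partition sum, and so
      by the limit \<open>T\<close>.\<close>
    have "stopped u t * r = r" if "t \<le> u" for t
      using that r by (simp add: projection_le_iff is_projection_stopped)
    then have "eventually (\<lambda>\<theta>. ?X \<theta> * r = r) ?F"
      using partition
      by (auto elim!: eventually_mono intro!: partition_sum_mult simp: partitions_def subset_iff)
    then have "T * r = r"
      by (rule strong_limit_mult_right[OF refinement_neq_bot lim])
    with T r show ?thesis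
      by (simp add: projection_le_iff)
  qed
  ultimately show ?thesis
    using T by (auto simp: is_projection_Inf_def time_projection_eqI[OF lim] is_projection_stopped)
qed

end


section \<open>Projections associated with a filtration\<close>

lemma commutant_mult:
  assumes "a \<in> commutant S" "b \<in> commutant S"
  shows "a * b \<in> commutant S"
  unfolding commutant_def
proof (intro CollectI ballI)
  fix x
  assume "x \<in> S"
  with assms have "a * x = x * a" "b * x = x * b"
    by (auto simp: commutant_def)
  then show "a * b * x = x * (a * b)"
    by (metis mult.assoc)
qed

lemma von_neumann_algebra_mult:
  "von_neumann_algebra M \<Longrightarrow> a \<in> M \<Longrightarrow> b \<in> M \<Longrightarrow> a * b \<in> M"
  unfolding von_neumann_algebra_def by (metis commutant_mult)

text \<open>Invariance of the range gives \<open>p * a * p = a * p\<close>. The left side is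
  self-adjoint, so \<open>a * p\<close> equals its own adjoint \<open>p * a\<close>.\<close>

lemma self_adjoint_commute_projection:
  assumes p: "is_projection p" and a: "is_adjoint a a"
    and invariant: "\<And>v. v \<in> range (apply_op p) \<Longrightarrow> apply_op a v \<in> range (apply_op p)"
  shows "a * p = p * a"
proof -
  have pap: "p * (a * p) = a * p"
  proof (rule apply_op_eqI)
    fix v
    show "apply_op (p * (a * p)) v = apply_op (a * p) v"
      using projection_fixes_range[OF p invariant[OF rangeI]] by (simp add: apply_op_mult)
  qed
  have "is_adjoint (p * (a * p)) (p * (a * p))"
    using is_adjoint_mult[OF is_adjoint_mult[of p p a a], of p p] p a
    by (simp add: is_projection_def mult.assoc)
  then have "is_adjoint (a * p) (a * p)"
    by (simp add: pap)
  moreover have "is_adjoint (a * p) (p * a)"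
    using p a by (simp add: is_adjoint_mult is_projection_def)
  ultimately show ?thesis by (rule is_adjoint_unique)
qed

text \<open>Products stay in \<open>M\<close>, so \<open>a\<close> maps the orbit of
  \<open>\<Omega>\<close> into itself, and by continuity also its closure, the range of
  \<open>p\<close>.\<close>

lemma projection_onto_orbit_commute:
  assumes M: "von_neumann_algebra M" and a: "a \<in> M" "is_adjoint a a"
    and p: "is_projection_onto p (closure ((\<lambda>x. apply_op x \<Omega>) ` M))"
  shows "a * p = p * a"
proof (rule self_adjoint_commute_projection[OF _ a(2)])
  let ?S = "(\<lambda>x. apply_op x \<Omega>) ` M"
  show "is_projection p"
    using p by (simp add: is_projection_onto_def)
  fix v
  assume "v \<in> range (apply_op p)"
  then have "apply_op a v \<in> apply_op a ` closure ?S"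
    using p by (simp add: is_projection_onto_def)
  also have "\<dots> \<subseteq> closure (apply_op a ` ?S)"
    by (rule closure_bounded_linear_image_subset[OF bounded_linear_apply_op])
  also have "\<dots> \<subseteq> closure ?S"
    using von_neumann_algebra_mult[OF M a(1)]
    by (intro closure_mono) (auto simp flip: apply_op_mult)
  finally show "apply_op a v \<in> range (apply_op p)"
    using p by (simp add: is_projection_onto_def)
qed

lemma projection_onto_mono:
  assumes "is_projection_onto p K" "is_projection_onto p' K'" "K \<subseteq> K'"
  shows "p \<le> p'"
proof -
  have "p' * p = p"
    using assms projection_fixes_range[of p']
    by (intro apply_op_eqI) (auto simp: is_projection_onto_def apply_op_simps)
  with assms show ?thesis
    by (simp add: is_projection_onto_def projection_le_iff)
qed

lemma projection_le_one: "is_projection p \<Longrightarrow> p \<le> 1"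
  by (simp add: projection_le_iff is_projection_one)

text \<open>At finite times the locale assumptions come from adaptedness and the growth of the
  algebras; at \<open>top\<close> they follow from \<open>q top = 1\<close> and
  \<open>P top = 1\<close>, for both kinds of stopping time.\<close>

lemma adapted_projections_filtration:
  assumes filt: "filtration M A" and P: "filtration_projections \<Omega> A P"
    and q: "stopping_time A q"
  shows "adapted_projections q P"
proof
  have q_fin: "is_projection (q t)" "q t \<in> A t" if "t < top" for t
    using q that by (auto simp: stopping_time_def stopping_time_on_def)
  have q_top: "q top = 1"
    using q by (auto simp: stopping_time_def)
  have P_fin: "is_projection_onto (P t) (closure ((\<lambda>x. apply_op x \<Omega>) ` A t))" if "t < top" for t
    using P that by (simp add: filtration_projections_def)
  have P_top: "P top = 1"
    using P by (simp add: filtration_projections_def)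
  have A_mono: "A s \<subseteq> A t" if "s \<le> t" "t < top" for s t
    using filt that by (auto simp: filtration_def mono_on_def)
  show proj_q: "is_projection (q t)" for t
    using q_fin(1)[of t] q_top is_projection_one by (cases "t = top") (auto simp: less_top)
  show proj_P: "is_projection (P t)" for t
    using P_fin[of t] P_top is_projection_one
    by (cases "t = top") (auto simp: less_top is_projection_onto_def)
  show "mono q"
  proof
    fix s t :: ennreal
    assume "s \<le> t"
    show "q s \<le> q t"
    proof (cases "t = top")
      case True
      then show ?thesis using q_top projection_le_one[OF proj_q] by simp
    next
      case False
      then have "t < top" by (simp add: less_top)
      moreover have "mono_on {0..<top} q"
        using q by (auto simp: stopping_time_def stopping_time_on_def mono_on_def)
      ultimately show ?thesis
        using \<open>s \<le> t\<close> by (auto simp: mono_on_def)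
    qed
  qed
  show "mono P"
  proof
    fix s t :: ennreal
    assume "s \<le> t"
    show "P s \<le> P t"
    proof (cases "t = top")
      case True
      then show ?thesis using P_top projection_le_one[OF proj_P] by simp
    next
      case False
      then have "t < top" by (simp add: less_top)
      then show ?thesis
        using \<open>s \<le> t\<close> A_mono[of s t]
        by (intro projection_onto_mono[OF P_fin P_fin] closure_mono image_mono) auto
    qed
  qed
  show "q s * P t = P t * q s" if "s \<le> t" for s t
  proof (cases "t = top")
    case True
    then show ?thesis by (simp add: P_top)
  next
    case False
    then have t: "t < top" by (simp add: less_top)
    \<comment> \<open>Adaptedness puts \<open>q s\<close> into \<open>A s\<close>, which is
      contained in \<open>A t\<close>, the algebra whose orbit closure is the range of
      \<open>P t\<close>.\<close>
    then have "q s \<in> A t"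
      using that A_mono[of s t] q_fin(2)[of s] by auto
    moreover have "von_neumann_algebra (A t)"
      using filt t by (simp add: filtration_def)
    ultimately show ?thesis
      using proj_q[of s] P_fin[OF t]
      by (intro projection_onto_orbit_commute) (auto simp: is_projection_def)
  qed
  show "q 0 = 0"
    using q by (auto simp: stopping_time_def stopping_time_on_def)
qed

theorem theorem1:
  fixes M :: "'a::complex_hilbert_space bounded_op set"
    and \<Omega> :: 'a
    and A :: "ennreal \<Rightarrow> 'a bounded_op set"
    and E :: "ennreal \<Rightarrow> 'a bounded_op \<Rightarrow> 'a bounded_op"
    and P q :: "ennreal \<Rightarrow> 'a bounded_op"
    and u :: ennreal
  assumes "von_neumann_algebra M"
    and "cyclic_vector M \<Omega>"
    and "separating_vector M \<Omega>"
    and "filtration M A"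
    and "compatible_expectations M \<Omega> A E"
    and "filtration_projections \<Omega> A P"
    and "stopping_time A q"
    and "0 < u"
  shows "is_projection_Inf ((\<lambda>t. q u - q t * (1 - P t)) ` {0..u}) (time_projection q P u)"
proof -
  interpret adapted_projections q P
    using assms by (intro adapted_projections_filtration)
  have "stopped u = (\<lambda>t. q u - q t * (1 - P t))"
    by (simp add: stopped_def fun_eq_iff)
  then show ?thesis
    using time_projection_Inf[of u] by simp
qed

end
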